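(* Let $q_0>0$ satisfy $$\frac{(T_0-T_{0l})k_l}{\sqrt{\pi \alpha_l}}<q_0<\frac{(T_0-T_{0s})k_l}{\sqrt{\pi \alpha_l}},$$ let $(\lambda,T_k)$ be the pair determining the similarity solution of problem $(P_1)$ (see the context), and let $$T_1=T_k-\frac{q_0}{k_s}\sqrt{\alpha_s\pi}\,\mathrm{erf}(\lambda)$$ be the corresponding temperature at $x=0$. Then the coefficient $\mu$ of the free boundary $\widetilde s(t)=2\mu\sqrt{\alpha_st}$ and the solidification temperature $\widetilde T_k$ of the Rubinstein solution of problem $(P_R)$ with this value of $T_1$ satisfy $$\frac{\sqrt{\alpha_l}}{\sqrt{\alpha_s}}\,\frac{\widetilde T_k-T_1}{T_0-T_{0s}}\,\frac{k_s}{k_l}<\mathrm{erf}(\mu)<\frac{\sqrt{\alpha_l}}{\sqrt{\alpha_s}}\,\frac{\widetilde T_k-T_1}{T_0-T_{0l}}\,\frac{k_s}{k_l}.$$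
   Context: Data. $\alpha_s,\alpha_l,d_s,d_l,k_s,k_l,\rho,\gamma$ are positive constants (subscripts $s$, $l$: solid, liquid). $T_A<T_B$ are real numbers, and $f_l,f_s:[T_A,T_B]\to\mathbb R$ are continuous strictly increasing functions with $$f_l(T_A)=f_s(T_A)<f_l(T)<f_s(T)<f_l(T_B)=f_s(T_B),\quad T_A<T<T_B.$$ $C_0$ is a constant with $f_l(T_A)<C_0<f_l(T_B)$, and $T_{0l}=f_l^{-1}(C_0)$, $T_{0s}=f_s^{-1}(C_0)$. $T_0$ is a constant with $T_A<T_0<T_B$. The alloy is initially liquid, i.e. $C_0<f_l(T_0)$. Problem $(P_1)$. Find $s(t)>0$ ($t>0$), a constant $T_k\in(T_A,T_B)$, functions $T_s,C_s$ on $0<x<s(t)$, $t>0$, and $T_l,C_l$ on $x>s(t)$, $t>0$, such that, for all $t>0$: (i) $\alpha_s T_{s,xx}=T_{s,t}$ for $0<x<s(t)$; (ii) $\alpha_l T_{l,xx}=T_{l,t}$ for $x>s(t)$; (iii) $d_s C_{s,xx}=C_{s,t}$ for $0<x<s(t)$; (iv) $d_l C_{l,xx}=C_{l,t}$ for $x>s(t)$; (v) $k_s T_{s,x}(0,t)=q_0/\sqrt t$; (vi) $T_s(s(t),t)=T_l(s(t),t)=T_k$; (vii) $T_l(x,0)=T_0$ for $x>0$; (viii) $T_l(\infty,t)=T_0$; (ix) $C_{s,x}(0,t)=0$; (x) $C_s(s(t),t)=f_s(T_k)$; (xi) $C_l(x,0)=C_0$ for $x>0$; (xii) $C_l(s(t),t)=f_l(T_k)$;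 (xiii) $k_sT_{s,x}(s(t),t)-k_lT_{l,x}(s(t),t)=\gamma\rho s'(t)$; (xiv) $d_lC_{l,x}(s(t),t)-d_sC_{s,x}(s(t),t)=[f_s(T_k)-f_l(T_k)]s'(t)$. Problem $(P_R)$ is obtained from $(P_1)$ by replacing (v) by the condition that the solid temperature at $x=0$ equals the constant $T_1$ for all $t>0$. Functions. $\mathrm{erf}(x)=\frac{2}{\sqrt\pi}\int_0^x e^{-t^2}dt$, $\mathrm{erfc}=1-\mathrm{erf}$; write $c=\sqrt{\alpha_s/\alpha_l}$. For $x>0$: $$Q(x)=\sqrt{\pi}\,x e^{x^2}\mathrm{erfc}(x),\quad Q_1(x)=\sqrt\pi\,xe^{x^2}\mathrm{erf}(x),\quad F_1(x)=e^{x^2}\mathrm{erfc}(x),\quad M(x)=\Big[Q\big(\sqrt{\alpha_s/d_l}\,x\big)\Big]^{-1},$$ $$F(x)=T_0+\frac{\gamma\rho\alpha_l}{k_l}Q(cx)-\frac{q_0}{k_l}\sqrt{\alpha_l\pi}\,e^{-x^2}F_1(cx),$$ $$G(x)=\frac{\gamma\rho\alpha_s\alpha_lQ_1(x)Q(cx)+T_1k_s\alpha_lQ(cx)+T_0k_l\alpha_sQ_1(x)}{k_s\alpha_lQ(cx)+k_l\alpha_sQ_1(x)},$$ and $\phi(x)=\frac{f_s(x)-f_l(x)}{C_0-f_l(x)}$ for $x\in(T_A,T_{0l})\cup(T_{0l},T_B)$. The similarity solution of $(P_1)$ has $s(t)=2\lambda\sqrt{\alpha_st}$ and $T_s(x,t)=T_k-\frac{q_0}{k_s}\sqrt{\pi\alpha_s}\,\mathrm{erf}(\lambda)+\frac{q_0}{k_s}\sqrt{\pi\alpha_s}\,\mathrm{erf}\big(\frac{x}{2\sqrt{\alpha_st}}\big)$,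 where $(\lambda,T_k)$ is the unique pair with $T_k=F(\lambda)$, $M(\lambda)=\phi(T_k)$, $\lambda>0$, $T_A<T_k<T_B$. The Rubinstein solution of $(P_R)$ has $\widetilde s(t)=2\mu\sqrt{\alpha_st}$ and $\widetilde T_s(x,t)=T_1+\frac{\widetilde T_k-T_1}{\mathrm{erf}(\mu)}\mathrm{erf}\big(\frac{x}{2\sqrt{\alpha_st}}\big)$, where $(\mu,\widetilde T_k)$ is the (unique) pair with $\widetilde T_k=G(\mu)$, $M(\mu)=\phi(\widetilde T_k)$, $\mu>0$, $T_A<\widetilde T_k<T_B$. *)

theory Defs
  imports "HOL-Probability.Probability"
begin

record alloy =
  \<alpha>_s :: real
  \<alpha>_l :: real
  d_s :: real
  d_l :: real
  k_s :: real
  k_l :: real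
  \<rho> :: real
  \<gamma> :: real
  T_A :: real
  T_B :: real
  f_l :: "real \<Rightarrow> real"
  f_s :: "real \<Rightarrow> real"
  C_0 :: real
  T_0 :: real

text \<open>The liquidus \<open>f_l\<close> and the solidus \<open>f_s\<close> are total functions here;
  only their values on \<open>{T_A..T_B}\<close> are constrained.\<close>

definition admissible :: "alloy \<Rightarrow> bool" where
  "admissible A \<longleftrightarrow>
     \<alpha>_s A > 0 \<and> \<alpha>_l A > 0 \<and> d_s A > 0 \<and> d_l A > 0 \<and> k_s A > 0 \<and> k_l A > 0 \<and>
     \<rho> A > 0 \<and> \<gamma> A > 0 \<and>
     T_A A < T_B A \<and>
     continuous_on {T_A A..T_B A} (f_l A) \<and> strict_mono_on {T_A A..T_B A} (f_l A) \<and>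
     continuous_on {T_A A..T_B A} (f_s A) \<and> strict_mono_on {T_A A..T_B A} (f_s A) \<and>
     f_l A (T_A A) = f_s A (T_A A) \<and> f_l A (T_B A) = f_s A (T_B A) \<and>
     (\<forall>T\<in>{T_A A<..<T_B A}.
        f_s A (T_A A) < f_l A T \<and> f_l A T < f_s A T \<and> f_s A T < f_l A (T_B A)) \<and>
     f_l A (T_A A) < C_0 A \<and> C_0 A < f_l A (T_B A) \<and>
     T_A A < T_0 A \<and> T_0 A < T_B A \<and>
     C_0 A < f_l A (T_0 A)"

definition T_0l :: "alloy \<Rightarrow> real" where
  "T_0l A = the_inv_into {T_A A..T_B A} (f_l A) (C_0 A)"

definition T_0s :: "alloy \<Rightarrow> real" where
  "T_0s A = the_inv_into {T_A A..T_B A} (f_s A) (C_0 A)"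

definition erf :: "real \<Rightarrow> real" where
  "erf x = 2 / sqrt pi * (LBINT t=0..x. exp (- t\<^sup>2))"

definition erfc :: "real \<Rightarrow> real" where
  "erfc x = 1 - erf x"

definition Q_fun :: "real \<Rightarrow> real" where
  "Q_fun x = sqrt pi * x * exp (x\<^sup>2) * erfc x"

definition Q1_fun :: "real \<Rightarrow> real" where
  "Q1_fun x = sqrt pi * x * exp (x\<^sup>2) * erf x"

definition F1_fun :: "real \<Rightarrow> real" where
  "F1_fun x = exp (x\<^sup>2) * erfc x"

definition c_ratio :: "alloy \<Rightarrow> real" where
  "c_ratio A = sqrt (\<alpha>_s A / \<alpha>_l A)"

definition M_fun :: "alloy \<Rightarrow> real \<Rightarrow> real" where
  "M_fun A x = inverse (Q_fun (sqrt (\<alpha>_s A / d_l A) * x))"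

definition F_fun :: "alloy \<Rightarrow> real \<Rightarrow> real \<Rightarrow> real" where
  "F_fun A q0 x = T_0 A + \<gamma> A * \<rho> A * \<alpha>_l A / k_l A * Q_fun (c_ratio A * x)
     - q0 / k_l A * sqrt (\<alpha>_l A * pi) * exp (- x\<^sup>2) * F1_fun (c_ratio A * x)"

definition G_fun :: "alloy \<Rightarrow> real \<Rightarrow> real \<Rightarrow> real" where
  "G_fun A T1 x =
     (\<gamma> A * \<rho> A * \<alpha>_s A * \<alpha>_l A * Q1_fun x * Q_fun (c_ratio A * x)
        + T1 * k_s A * \<alpha>_l A * Q_fun (c_ratio A * x)
        + T_0 A * k_l A * \<alpha>_s A * Q1_fun x)
     / (k_s A * \<alpha>_l A * Q_fun (c_ratio A * x) + k_l A * \<alpha>_s A * Q1_fun x)"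

text \<open>Meaningful only on \<open>{T_A<..<T_0l} \<union> {T_0l<..<T_B}\<close>; membership in this set is
  required wherever \<open>phi\<close> is used.\<close>

definition phi :: "alloy \<Rightarrow> real \<Rightarrow> real" where
  "phi A T = (f_s A T - f_l A T) / (C_0 A - f_l A T)"

definition phi_dom :: "alloy \<Rightarrow> real set" where
  "phi_dom A = {T_A A<..<T_0l A} \<union> {T_0l A<..<T_B A}"

definition dx :: "(real \<Rightarrow> real \<Rightarrow> real) \<Rightarrow> real \<Rightarrow> real \<Rightarrow> real" where
  "dx u x t = deriv (\<lambda>y. u y t) x"

definition dt :: "(real \<Rightarrow> real \<Rightarrow> real) \<Rightarrow> real \<Rightarrow> real \<Rightarrow> real" where
  "dt u x t = deriv (\<lambda>r. u x r) t"

definition heat_equation ::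
  "real \<Rightarrow> (real \<Rightarrow> real \<Rightarrow> real) \<Rightarrow> (real \<times> real) set \<Rightarrow> bool" where
  "heat_equation a u D \<longleftrightarrow>
     (\<forall>(x, t)\<in>D.
        (\<lambda>y. u y t) differentiable at x \<and>
        (\<lambda>y. dx u y t) differentiable at x \<and>
        (\<lambda>r. u x r) differentiable at t \<and>
        a * dx (dx u) x t = dt u x t)"

text \<open>The conditions shared by both free boundary problems. The unknown functions live on open
  regions, so the values of a function or of its \<open>x\<close>-derivative at \<open>x = 0\<close>, \<open>x = s(t)\<close>,
  \<open>t = 0\<close> and \<open>x = \<infinity>\<close> are the limits taken from inside its region.\<close>

definition alloy_problem ::
  "alloy \<Rightarrow> (real \<Rightarrow> real) \<Rightarrow> real \<Rightarrow> (real \<Rightarrow> real \<Rightarrow> real) \<Rightarrow> (real \<Rightarrow> real \<Rightarrow> real) \<Rightarrow>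
   (real \<Rightarrow> real \<Rightarrow> real) \<Rightarrow> (real \<Rightarrow> real \<Rightarrow> real) \<Rightarrow> bool" where
  "alloy_problem A s Tk Ts Cs Tl Cl \<longleftrightarrow>
     Tk \<in> {T_A A<..<T_B A} \<and>
     (\<forall>t>0. s t > 0 \<and> s differentiable at t) \<and>
     heat_equation (\<alpha>_s A) Ts {(x, t). 0 < t \<and> 0 < x \<and> x < s t} \<and>
     heat_equation (\<alpha>_l A) Tl {(x, t). 0 < t \<and> s t < x} \<and>
     heat_equation (d_s A) Cs {(x, t). 0 < t \<and> 0 < x \<and> x < s t} \<and>
     heat_equation (d_l A) Cl {(x, t). 0 < t \<and> s t < x} \<and>
     (\<forall>x>0. ((\<lambda>t. Tl x t) \<longlongrightarrow> T_0 A) (at_right 0)) \<and>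
     (\<forall>x>0. ((\<lambda>t. Cl x t) \<longlongrightarrow> C_0 A) (at_right 0)) \<and>
     (\<forall>t>0.
        ((\<lambda>x. Ts x t) \<longlongrightarrow> Tk) (at_left (s t)) \<and>
        ((\<lambda>x. Tl x t) \<longlongrightarrow> Tk) (at_right (s t)) \<and>
        ((\<lambda>x. Tl x t) \<longlongrightarrow> T_0 A) at_top \<and>
        ((\<lambda>x. dx Cs x t) \<longlongrightarrow> 0) (at_right 0) \<and>
        ((\<lambda>x. Cs x t) \<longlongrightarrow> f_s A Tk) (at_left (s t)) \<and>
        ((\<lambda>x. Cl x t) \<longlongrightarrow> f_l A Tk) (at_right (s t)) \<and>
        (\<exists>Ts_x Tl_x.
           ((\<lambda>x. dx Ts x t) \<longlongrightarrow> Ts_x) (at_left (s t)) \<and>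
           ((\<lambda>x. dx Tl x t) \<longlongrightarrow> Tl_x) (at_right (s t)) \<and>
           k_s A * Ts_x - k_l A * Tl_x = \<gamma> A * \<rho> A * deriv s t) \<and>
        (\<exists>Cs_x Cl_x.
           ((\<lambda>x. dx Cs x t) \<longlongrightarrow> Cs_x) (at_left (s t)) \<and>
           ((\<lambda>x. dx Cl x t) \<longlongrightarrow> Cl_x) (at_right (s t)) \<and>
           d_l A * Cl_x - d_s A * Cs_x = (f_s A Tk - f_l A Tk) * deriv s t))"

definition problem_P1 ::
  "alloy \<Rightarrow> real \<Rightarrow> (real \<Rightarrow> real) \<Rightarrow> real \<Rightarrow> (real \<Rightarrow> real \<Rightarrow> real) \<Rightarrow> (real \<Rightarrow> real \<Rightarrow> real) \<Rightarrow>
   (real \<Rightarrow> real \<Rightarrow> real) \<Rightarrow> (real \<Rightarrow> real \<Rightarrow> real) \<Rightarrow> bool" where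
  "problem_P1 A q0 s Tk Ts Cs Tl Cl \<longleftrightarrow>
     alloy_problem A s Tk Ts Cs Tl Cl \<and>
     (\<forall>t>0. \<exists>Ts_x. ((\<lambda>x. dx Ts x t) \<longlongrightarrow> Ts_x) (at_right 0) \<and> k_s A * Ts_x = q0 / sqrt t)"

definition problem_PR ::
  "alloy \<Rightarrow> real \<Rightarrow> (real \<Rightarrow> real) \<Rightarrow> real \<Rightarrow> (real \<Rightarrow> real \<Rightarrow> real) \<Rightarrow> (real \<Rightarrow> real \<Rightarrow> real) \<Rightarrow>
   (real \<Rightarrow> real \<Rightarrow> real) \<Rightarrow> (real \<Rightarrow> real \<Rightarrow> real) \<Rightarrow> bool" where
  "problem_PR A T1 s Tk Ts Cs Tl Cl \<longleftrightarrow>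
     alloy_problem A s Tk Ts Cs Tl Cl \<and>
     (\<forall>t>0. ((\<lambda>x. Ts x t) \<longlongrightarrow> T1) (at_right 0))"

definition similarity_pair :: "alloy \<Rightarrow> real \<Rightarrow> real \<Rightarrow> real \<Rightarrow> bool" where
  "similarity_pair A q0 lam Tk \<longleftrightarrow>
     lam > 0 \<and> Tk \<in> {T_A A<..<T_B A} \<and> Tk = F_fun A q0 lam \<and>
     Tk \<in> phi_dom A \<and> M_fun A lam = phi A Tk"

definition rubinstein_pair :: "alloy \<Rightarrow> real \<Rightarrow> real \<Rightarrow> real \<Rightarrow> bool" where
  "rubinstein_pair A T1 mu Tk \<longleftrightarrow>
     mu > 0 \<and> Tk \<in> {T_A A<..<T_B A} \<and> Tk = G_fun A T1 mu \<and>
     Tk \<in> phi_dom A \<and> M_fun A mu = phi A Tk"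

definition similarity_solution ::
  "alloy \<Rightarrow> real \<Rightarrow> real \<Rightarrow> (real \<Rightarrow> real) \<Rightarrow> real \<Rightarrow> (real \<Rightarrow> real \<Rightarrow> real) \<Rightarrow>
   (real \<Rightarrow> real \<Rightarrow> real) \<Rightarrow> (real \<Rightarrow> real \<Rightarrow> real) \<Rightarrow> (real \<Rightarrow> real \<Rightarrow> real) \<Rightarrow> bool" where
  "similarity_solution A q0 lam s Tk Ts Cs Tl Cl \<longleftrightarrow>
     problem_P1 A q0 s Tk Ts Cs Tl Cl \<and>
     similarity_pair A q0 lam Tk \<and>
     (\<forall>t>0. s t = 2 * lam * sqrt (\<alpha>_s A * t)) \<and>
     (\<forall>t>0. \<forall>x\<in>{0<..<s t}.
        Ts x t = Tk - q0 / k_s A * sqrt (pi * \<alpha>_s A) * erf lam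
          + q0 / k_s A * sqrt (pi * \<alpha>_s A) * erf (x / (2 * sqrt (\<alpha>_s A * t))))"

definition rubinstein_solution ::
  "alloy \<Rightarrow> real \<Rightarrow> real \<Rightarrow> (real \<Rightarrow> real) \<Rightarrow> real \<Rightarrow> (real \<Rightarrow> real \<Rightarrow> real) \<Rightarrow>
   (real \<Rightarrow> real \<Rightarrow> real) \<Rightarrow> (real \<Rightarrow> real \<Rightarrow> real) \<Rightarrow> (real \<Rightarrow> real \<Rightarrow> real) \<Rightarrow> bool" where
  "rubinstein_solution A T1 mu s Tk Ts Cs Tl Cl \<longleftrightarrow>
     problem_PR A T1 s Tk Ts Cs Tl Cl \<and>
     rubinstein_pair A T1 mu Tk \<and>
     (\<forall>t>0. s t = 2 * mu * sqrt (\<alpha>_s A * t)) \<and>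
     (\<forall>t>0. \<forall>x\<in>{0<..<s t}.
        Ts x t = T1 + (Tk - T1) / erf mu * erf (x / (2 * sqrt (\<alpha>_s A * t))))"

text \<open>Every pair of coefficients is realised: \<open>similarity_solution_ex\<close> and
  \<open>rubinstein_solution_ex\<close> below construct the full solutions, so the differential problems
  inside the two solution predicates do not restrict the pairs any further.\<close>

lemma erf_0 [simp]: "erf 0 = 0"
  by (simp add: erf_def flip: zero_ereal_def)

lemma erf_deriv: "(erf has_real_derivative 2 / sqrt pi * exp (- x\<^sup>2)) (at x)"
proof -
  define a b where "a = min 0 (x - 1)" and "b = max 0 (x + 1)"
  have ab: "a \<le> 0" "0 \<le> b" "a < x" "x < b" by (auto simp: a_def b_def)
  have "((\<lambda>u. LBINT t=ereal 0..ereal u. exp (- t\<^sup>2)) has_vector_derivative exp (- x\<^sup>2)) (at x within {a..b})"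
    by (rule interval_integral_FTC2) (use ab in \<open>auto intro!: continuous_intros\<close>)
  then have "((\<lambda>u. LBINT t=0..u. exp (- t\<^sup>2)) has_vector_derivative exp (- x\<^sup>2)) (at x)"
    using ab by (simp add: at_within_Icc_at zero_ereal_def)
  then have "((\<lambda>u. LBINT t=0..u. exp (- t\<^sup>2)) has_real_derivative exp (- x\<^sup>2)) (at x)"
    by (simp add: has_real_derivative_iff_has_vector_derivative)
  from DERIV_cmult[OF this, of "2 / sqrt pi"] show ?thesis
    by (simp add: erf_def[abs_def])
qed

lemma erf_strict_mono: assumes "x < y" shows "erf x < erf y"
  using assms
proof (rule DERIV_pos_imp_increasing)
  fix z :: real
  have "2 / sqrt pi * exp (- z\<^sup>2) > 0" by simp
  with erf_deriv[of z] show "\<exists>d. DERIV erf z :> d \<and> d > 0" by blast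
qed

lemma erf_at_top: "(erf \<longlongrightarrow> 1) at_top"
proof -
  have h: "has_bochner_integral lborel (\<lambda>x. indicator {0..} x *\<^sub>R exp (- x\<^sup>2)) (sqrt pi / 2)"
    by (rule gaussian_moment_0)
  have "((\<lambda>b. set_lebesgue_integral lborel {0..b} (\<lambda>x. exp (- x\<^sup>2)))
      \<longlongrightarrow> set_lebesgue_integral lborel {0..} (\<lambda>x. exp (- x\<^sup>2 :: real))) at_top"
    by (rule tendsto_set_lebesgue_integral_at_top)
       (use h in \<open>auto simp: set_integrable_def has_bochner_integral_iff\<close>)
  then have "((\<lambda>b. set_lebesgue_integral lborel {0..b} (\<lambda>x. exp (- x\<^sup>2))) \<longlongrightarrow> sqrt pi / 2) at_top"
    using has_bochner_integral_integral_eq[OF h] by (simp only: set_lebesgue_integral_def)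
  then have "((\<lambda>b. 2 / sqrt pi * set_lebesgue_integral lborel {0..b} (\<lambda>x. exp (- x\<^sup>2))) \<longlongrightarrow> 2 / sqrt pi * (sqrt pi / 2)) at_top"
    by (intro tendsto_intros)
  moreover have "\<forall>\<^sub>F b in at_top. 2 / sqrt pi * set_lebesgue_integral lborel {0..b} (\<lambda>x. exp (- x\<^sup>2)) = erf b"
    using eventually_ge_at_top[of 0]
    by eventually_elim (simp add: erf_def interval_integral_Icc zero_ereal_def)
  ultimately show ?thesis
    by (simp add: tendsto_cong)
qed

lemma erf_lt_1: "erf x < 1"
proof -
  have "erf x < erf (x + 1)" by (rule erf_strict_mono) simp
  moreover have "\<forall>\<^sub>F y in at_top. erf (x + 1) \<le> erf y"
    using eventually_gt_at_top[of "x + 1"] by eventually_elim (rule less_imp_le[OF erf_strict_mono])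
  then have "erf (x + 1) \<le> 1"
    by (rule tendsto_lowerbound[OF erf_at_top]) simp
  ultimately show ?thesis by (rule less_le_trans)
qed

lemma erfc_pos: "erfc x > 0" using erf_lt_1[of x] by (simp add: erfc_def)
lemma erf_pos: "x > 0 \<Longrightarrow> erf x > 0" using erf_strict_mono[of 0 x] by simp

lemma prof_dt_aux:
  fixes a t w x :: real
  assumes "w * w = a * t" "w > 0" "a > 0"
  shows "x / 2 * (- (inverse w * (inverse w / 2 * a) * inverse w)) = - x / (4 * (w * t))"
proof -
  have t: "t = w * w / a" using assms by (simp add: field_simps)
  show ?thesis unfolding t using assms(2,3) by (simp add: field_simps)
qed

text \<open>\<open>prof a P R\<close> is a self-similar solution of the heat equation with diffusivity \<open>a\<close>.\<close>

definition prof :: "real \<Rightarrow> real \<Rightarrow> real \<Rightarrow> real \<Rightarrow> real \<Rightarrow> real" where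
  "prof a P R x t = P + R * erf (x / (2 * sqrt (a * t)))"

context
  fixes a P R :: real
  assumes a: "a > 0"
begin

lemma prof_dx: assumes "t > 0"
  shows "((\<lambda>y. prof a P R y t) has_real_derivative R / sqrt (pi * a * t) * exp (- x\<^sup>2 / (4 * a * t))) (at x)"
proof -
  have e: "(x / (2 * sqrt (a * t)))\<^sup>2 = x\<^sup>2 / (4 * a * t)"
    using a assms by (simp add: power_divide power_mult_distrib)
  have p: "sqrt (pi * a * t) = sqrt pi * sqrt (a * t)" by (simp add: real_sqrt_mult mult.assoc)
  have i: "((\<lambda>y. y / (2 * sqrt (a * t))) has_real_derivative 1 / (2 * sqrt (a * t))) (at x)"
    by (rule DERIV_cdivide[OF DERIV_ident])
  have "((\<lambda>y. prof a P R y t) has_real_derivative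
     0 + R * (2 / sqrt pi * exp (- (x / (2 * sqrt (a * t)))\<^sup>2) * (1 / (2 * sqrt (a * t))))) (at x)"
    unfolding prof_def
    by (intro DERIV_add DERIV_const DERIV_cmult DERIV_chain2[OF erf_deriv] i)
  then show ?thesis unfolding e p
    by (rule back_subst) (use a assms in \<open>simp add: field_simps\<close>)
qed

lemma prof_dx': "t > 0 \<Longrightarrow> dx (prof a P R) x t = R / sqrt (pi * a * t) * exp (- x\<^sup>2 / (4 * a * t))"
  unfolding dx_def by (rule DERIV_imp_deriv[OF prof_dx])

lemma prof_dxx: assumes "t > 0"
  shows "((\<lambda>y. dx (prof a P R) y t) has_real_derivative
    R / sqrt (pi * a * t) * exp (- x\<^sup>2 / (4 * a * t)) * (- x / (2 * a * t))) (at x)"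
  unfolding prof_dx'[OF assms]
proof -
  have "((\<lambda>y. - y\<^sup>2 / (4 * a * t)) has_real_derivative - (2 * x) / (4 * a * t)) (at x)"
    by (rule DERIV_cdivide) (auto intro!: derivative_eq_intros)
  from DERIV_cmult[OF DERIV_chain2[OF DERIV_exp this], of "R / sqrt (pi * a * t)"]
  show "((\<lambda>y. R / sqrt (pi * a * t) * exp (- y\<^sup>2 / (4 * a * t))) has_real_derivative
    R / sqrt (pi * a * t) * exp (- x\<^sup>2 / (4 * a * t)) * (- x / (2 * a * t))) (at x)"
    by (rule back_subst) simp
qed

lemma prof_dt: assumes "t > 0"
  shows "((\<lambda>r. prof a P R x r) has_real_derivative
    a * (R / sqrt (pi * a * t) * exp (- x\<^sup>2 / (4 * a * t)) * (- x / (2 * a * t)))) (at t)"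
proof -
  have e: "(x / (2 * sqrt (a * t)))\<^sup>2 = x\<^sup>2 / (4 * a * t)"
    using a assms by (simp add: power_divide power_mult_distrib)
  have s: "sqrt (a * t) * sqrt (a * t) = a * t" using a assms by simp
  have s0: "sqrt (a * t) > 0" using a assms by simp
  have p: "sqrt (pi * a * t) = sqrt pi * sqrt (a * t)" by (simp add: real_sqrt_mult mult.assoc)
  have i: "((\<lambda>r. x / (2 * sqrt (a * r))) has_real_derivative - x / (4 * (sqrt (a * t) * t))) (at t)"
  proof -
    have at: "a * t > 0" using a assms by simp
    have d1: "((\<lambda>r. sqrt (a * r)) has_real_derivative inverse (sqrt (a * t)) / 2 * a) (at t)"
      by (rule DERIV_chain2[OF DERIV_real_sqrt[OF at] DERIV_cmult_Id])
    have "((\<lambda>r. x / 2 * inverse (sqrt (a * r))) has_real_derivative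
        x / 2 * (- (inverse (sqrt (a * t)) * (inverse (sqrt (a * t)) / 2 * a) * inverse (sqrt (a * t))))) (at t)"
      by (rule DERIV_cmult[OF DERIV_inverse'[OF d1]]) (use a assms in simp)
    then have "((\<lambda>r. x / 2 * inverse (sqrt (a * r))) has_real_derivative - x / (4 * (sqrt (a * t) * t))) (at t)"
      unfolding prof_dt_aux[OF s s0 a] .
    moreover have "x / 2 * inverse w = x / (2 * w)" for w :: real by (simp only: divide_inverse inverse_mult_distrib mult_ac)
    ultimately show ?thesis by (simp only:)
  qed
  have "((\<lambda>r. prof a P R x r) has_real_derivative
     0 + R * (2 / sqrt pi * exp (- (x / (2 * sqrt (a * t)))\<^sup>2) * (- x / (4 * (sqrt (a * t) * t))))) (at t)"
    unfolding prof_def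
    by (intro DERIV_add DERIV_const DERIV_cmult DERIV_chain2[OF erf_deriv] i)
  moreover have "0 + R * (2 / r * E * (- x / (4 * (w * t)))) = a * (R / (r * w) * E * (- x / (2 * a * t)))"
    for r E w :: real using a by (cases "r = 0"; cases "w = 0") (simp_all add: field_simps)
  ultimately show ?thesis unfolding e p by (simp only: minus_divide_left)
qed

lemma prof_heat: assumes "\<And>x t. (x, t) \<in> D \<Longrightarrow> t > 0" shows "heat_equation a (prof a P R) D"
  unfolding heat_equation_def
proof (clarify, intro conjI)
  fix x t assume "(x, t) \<in> D"
  then have t: "t > 0" by (rule assms)
  show "(\<lambda>y. prof a P R y t) differentiable at x"
    "(\<lambda>y. dx (prof a P R) y t) differentiable at x"
    "(\<lambda>r. prof a P R x r) differentiable at t"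
    unfolding real_differentiable_def
    by (rule exI, rule prof_dx[OF t], rule exI, rule prof_dxx[OF t], rule exI, rule prof_dt[OF t])
  show "a * dx (dx (prof a P R)) x t = dt (prof a P R) x t"
    unfolding dx_def[of "dx (prof a P R)" x t] dt_def[of "prof a P R" x t]
      DERIV_imp_deriv[OF prof_dt[OF t]] DERIV_imp_deriv[OF prof_dxx[OF t]] by (rule refl)
qed

lemma prof_lim: assumes "t > 0" shows "((\<lambda>x. prof a P R x t) \<longlongrightarrow> prof a P R y t) (at y within S)"
  by (rule tendsto_mono[OF at_le[OF subset_UNIV] DERIV_isCont[OF prof_dx[OF assms], unfolded isCont_def]])

lemma prof_dlim: assumes "t > 0"
  shows "((\<lambda>x. dx (prof a P R) x t) \<longlongrightarrow> R / sqrt (pi * a * t) * exp (- y\<^sup>2 / (4 * a * t))) (at y within S)"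
  using tendsto_mono[OF at_le[OF subset_UNIV] DERIV_isCont[OF prof_dxx[OF assms, of y], unfolded isCont_def]]
  by (simp only: prof_dx'[OF assms])

lemma prof_inf: assumes "t > 0" shows "((\<lambda>x. prof a P R x t) \<longlongrightarrow> P + R) at_top"
proof -
  have "filterlim (\<lambda>x. inverse (2 * sqrt (a * t)) * x) at_top at_top"
    by (rule filterlim_tendsto_pos_mult_at_top[OF tendsto_const]) (use a assms in \<open>auto simp: filterlim_ident\<close>)
  then have "filterlim (\<lambda>x. x / (2 * sqrt (a * t))) at_top at_top"
    by (simp only: divide_inverse mult.commute[of "inverse _"])
  from filterlim_compose[OF erf_at_top this] have "((\<lambda>x. P + R * erf (x / (2 * sqrt (a * t)))) \<longlongrightarrow> P + R * 1) at_top"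
    by (intro tendsto_intros)
  then show ?thesis by (simp add: prof_def)
qed

lemma prof_init: assumes "x > 0" shows "((\<lambda>t. prof a P R x t) \<longlongrightarrow> P + R) (at_right 0)"
proof -
  have "((\<lambda>t. 2 * sqrt (a * t)) \<longlongrightarrow> 2 * sqrt (a * 0)) (at_right 0)" by (intro tendsto_intros)
  then have "filterlim (\<lambda>t. inverse (2 * sqrt (a * t))) at_top (at_right 0)"
    using eventually_at_right_less[of 0] a
    by (intro filterlim_inverse_at_top) (auto elim!: eventually_mono)
  from filterlim_tendsto_pos_mult_at_top[OF tendsto_const assms this]
  have "filterlim (\<lambda>t. x / (2 * sqrt (a * t))) at_top (at_right 0)"
    by (simp only: divide_inverse)
  from filterlim_compose[OF erf_at_top this] have "((\<lambda>t. P + R * erf (x / (2 * sqrt (a * t)))) \<longlongrightarrow> P + R * 1) (at_right 0)"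
    by (intro tendsto_intros)
  then show ?thesis by (simp add: prof_def)
qed
end

lemma s_deriv: assumes "t > 0" "al > 0"
  shows "((\<lambda>t. 2 * l * sqrt (al * t)) has_real_derivative l * sqrt al / sqrt t) (at t)"
proof -
  have at: "al * t > 0" using assms by simp
  have "((\<lambda>t. 2 * l * sqrt (al * t)) has_real_derivative 2 * l * (inverse (sqrt (al * t)) / 2 * al)) (at t)"
    by (rule DERIV_cmult[OF DERIV_chain2[OF DERIV_real_sqrt[OF at] DERIV_cmult_Id]])
  also have "2 * l * (inverse (sqrt (al * t)) / 2 * al) = l * (al / sqrt al) / sqrt t"
    unfolding real_sqrt_mult using assms by (simp add: field_simps)
  also have "al / sqrt al = sqrt al" using assms by (simp add: real_div_sqrt)
  finally show ?thesis .
qed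

lemma alloy_problem_ex:
  assumes adm: "admissible A" and l: "l > 0" and Tk: "Tk \<in> {T_A A<..<T_B A}" "Tk \<in> phi_dom A"
    and M: "M_fun A l = phi A Tk"
    and P: "P + R * erf l = Tk"
    and st: "k_s A * R / (sqrt pi * sqrt (\<alpha>_s A)) * exp (- l\<^sup>2)
        + k_l A * (Tk - T_0 A) / (sqrt pi * sqrt (\<alpha>_l A) * F1_fun (c_ratio A * l)) = \<gamma> A * \<rho> A * l * sqrt (\<alpha>_s A)"
  shows "\<exists>Cs Tl Cl. alloy_problem A (\<lambda>t. 2 * l * sqrt (\<alpha>_s A * t)) Tk (prof (\<alpha>_s A) P R) Cs Tl Cl"
proof -
  have pos: "\<alpha>_s A > 0" "\<alpha>_l A > 0" "d_s A > 0" "d_l A > 0" "k_s A > 0" "k_l A > 0"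
    using adm by (auto simp: admissible_def)
  define c where "c = c_ratio A"
  define b where "b = sqrt (\<alpha>_s A / d_l A)"
  have c: "c > 0" "b > 0" using pos by (auto simp: c_def c_ratio_def b_def)
  define s where "s = (\<lambda>t. 2 * l * sqrt (\<alpha>_s A * t))"
  define q where "q = (Tk - T_0 A) / erfc (c * l)"
  define r where "r = (f_l A Tk - C_0 A) / erfc (b * l)"
  have sd: "deriv s t = l * sqrt (\<alpha>_s A) / sqrt t" "s differentiable at t" if "t > 0" for t
    using s_deriv[OF that pos(1), of l] DERIV_imp_deriv real_differentiable_def unfolding s_def by blast+
  have sl: "s t / (2 * sqrt (a * t)) = sqrt (\<alpha>_s A / a) * l" "(s t)\<^sup>2 / (4 * a * t) = (sqrt (\<alpha>_s A / a) * l)\<^sup>2"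
    if "t > 0" "a > 0" for a t
    using that pos by (simp_all add: s_def real_sqrt_mult real_sqrt_divide power_mult_distrib power_divide)
  have pT: "P + R * erf l = Tk" by (rule P)
  have e1: "prof (\<alpha>_s A) P R (s t) t = Tk" if "t > 0" for t
    using that pos P by (simp add: prof_def sl)
  have e2: "prof (\<alpha>_l A) (T_0 A + q) (- q) (s t) t = Tk" if "t > 0" for t
  proof -
    have "T_0 A + q + (- q) * erf (c * l) = T_0 A + q * erfc (c * l)" by (simp add: erfc_def algebra_simps)
    also have "\<dots> = Tk" using erfc_pos[of "c * l"] by (simp add: q_def)
    finally show ?thesis using that pos by (simp add: prof_def sl c_def c_ratio_def)
  qed
  have e3: "prof (d_l A) (C_0 A + r) (- r) (s t) t = f_l A Tk" if "t > 0" for t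
  proof -
    have "C_0 A + r + (- r) * erf (b * l) = C_0 A + r * erfc (b * l)" by (simp add: erfc_def algebra_simps)
    also have "\<dots> = f_l A Tk" using erfc_pos[of "b * l"] by (simp add: r_def)
    finally show ?thesis using that pos by (simp add: prof_def sl b_def)
  qed
  have d0: "dx (prof (d_s A) K 0) x t = 0" if "t > 0" for K x t
    using prof_dx'[OF pos(3) that, of K 0] by simp
  have inj: "inj_on (f_l A) {T_A A..T_B A}"
    using adm by (auto simp: admissible_def intro: strict_mono_on_imp_inj_on)
  have "C_0 A \<in> f_l A ` {T_A A..T_B A}"
    using adm IVT'[of "f_l A" "T_A A" "C_0 A" "T_B A"] by (force simp: admissible_def)
  then have T0l: "f_l A (T_0l A) = C_0 A" "T_0l A \<in> {T_A A..T_B A}"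
    unfolding T_0l_def using f_the_inv_into_f[OF inj] the_inv_into_into[OF inj _ subset_refl] by blast+
  have ne: "C_0 A - f_l A Tk \<noteq> 0"
    using T0l Tk inj_onD[OF inj, of Tk "T_0l A"] by (auto simp: phi_dom_def)
  have st': "k_s A * (R / sqrt (pi * \<alpha>_s A * t) * exp (- (s t)\<^sup>2 / (4 * \<alpha>_s A * t)))
     - k_l A * (- q / sqrt (pi * \<alpha>_l A * t) * exp (- (s t)\<^sup>2 / (4 * \<alpha>_l A * t))) = \<gamma> A * \<rho> A * deriv s t"
    if t: "t > 0" for t
  proof -
    have "k_s A * (R / sqrt (pi * \<alpha>_s A * t) * exp (- (s t)\<^sup>2 / (4 * \<alpha>_s A * t)))
     - k_l A * (- q / sqrt (pi * \<alpha>_l A * t) * exp (- (s t)\<^sup>2 / (4 * \<alpha>_l A * t)))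
     = (k_s A * R / (sqrt pi * sqrt (\<alpha>_s A)) * exp (- l\<^sup>2)
        + k_l A * (Tk - T_0 A) / (sqrt pi * sqrt (\<alpha>_l A) * F1_fun (c_ratio A * l))) / sqrt t"
      using t pos erfc_pos[of "c * l"]
      by (simp add: sl(2) minus_divide_left[symmetric] q_def F1_fun_def exp_minus real_sqrt_mult
          flip: c_ratio_def c_def) (simp add: field_simps)
    then show ?thesis using t st by (simp add: sd)
  qed
  have co': "d_l A * (- r / sqrt (pi * d_l A * t) * exp (- (s t)\<^sup>2 / (4 * d_l A * t))) = (f_s A Tk - f_l A Tk) * deriv s t"
    if t: "t > 0" for t
  proof -
    have cancel: "K * x / (p * z * g * h) = K * (x * x) / (p * x * z * g * h)" if "x \<noteq> 0" for K x p z g h :: real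
      using that by (cases "p = 0 \<or> z = 0 \<or> g = 0 \<or> h = 0") (auto simp: field_simps)
    have bs: "b * sqrt (d_l A) = sqrt (\<alpha>_s A)" using pos by (simp add: b_def real_sqrt_divide)
    have Qp: "Q_fun (b * l) > 0" using c l erfc_pos[of "b * l"] by (simp add: Q_fun_def)
    have "f_s A Tk - f_l A Tk = (C_0 A - f_l A Tk) / Q_fun (b * l)"
      using M ne by (simp add: M_fun_def phi_def b_def field_simps)
    then have "(f_s A Tk - f_l A Tk) * deriv s t = (C_0 A - f_l A Tk) / Q_fun (b * l) * (l * (b * sqrt (d_l A)) / sqrt t)"
      using t by (simp add: sd bs)
    also have "\<dots> = (C_0 A - f_l A Tk) * sqrt (d_l A) / (sqrt pi * sqrt t * exp ((b * l)\<^sup>2) * erfc (b * l))"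
      using c l t erfc_pos[of "b * l"] by (simp add: Q_fun_def field_simps)
    also have "\<dots> = (C_0 A - f_l A Tk) * (sqrt (d_l A) * sqrt (d_l A)) / (sqrt pi * sqrt (d_l A) * sqrt t * exp ((b * l)\<^sup>2) * erfc (b * l))"
      by (rule cancel) (use pos in simp)
    also have "\<dots> = d_l A * (- r / sqrt (pi * d_l A * t) * exp (- (s t)\<^sup>2 / (4 * d_l A * t)))"
      using t pos erfc_pos[of "b * l"]
      by (simp add: sl(2) minus_divide_left[symmetric] r_def exp_minus real_sqrt_mult
          flip: b_def) (simp add: field_simps)
    finally show ?thesis by simp
  qed
  have "alloy_problem A s Tk (prof (\<alpha>_s A) P R) (prof (d_s A) (f_s A Tk) 0)
     (prof (\<alpha>_l A) (T_0 A + q) (- q)) (prof (d_l A) (C_0 A + r) (- r))"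
    unfolding alloy_problem_def
  proof (intro conjI allI impI)
    show "Tk \<in> {T_A A<..<T_B A}" by fact
    fix t :: real assume t: "t > 0"
    show "s t > 0" using t l pos by (simp add: s_def)
    show "s differentiable at t" by (rule sd) fact
    show "(prof (\<alpha>_l A) (T_0 A + q) (- q) t \<longlongrightarrow> T_0 A) (at_right 0)"
      using prof_init[OF pos(2) t, of "T_0 A + q" "- q"] by simp
    show "(prof (d_l A) (C_0 A + r) (- r) t \<longlongrightarrow> C_0 A) (at_right 0)"
      using prof_init[OF pos(4) t, of "C_0 A + r" "- r"] by simp
    show "((\<lambda>x. prof (\<alpha>_s A) P R x t) \<longlongrightarrow> Tk) (at_left (s t))"
      using prof_lim[OF pos(1) t, of P R "s t"] t by (simp add: e1)
    show "((\<lambda>x. prof (\<alpha>_l A) (T_0 A + q) (- q) x t) \<longlongrightarrow> Tk) (at_right (s t))"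
      using prof_lim[OF pos(2) t, of _ _ "s t"] t e2 by metis
    show "((\<lambda>x. prof (\<alpha>_l A) (T_0 A + q) (- q) x t) \<longlongrightarrow> T_0 A) at_top"
      using prof_inf[OF pos(2) t, of "T_0 A + q" "- q"] by simp
    show "((\<lambda>x. dx (prof (d_s A) (f_s A Tk) 0) x t) \<longlongrightarrow> 0) (at_right 0)"
      using t by (simp add: d0)
    show "((\<lambda>x. prof (d_s A) (f_s A Tk) 0 x t) \<longlongrightarrow> f_s A Tk) (at_left (s t))"
      by (simp add: prof_def)
    show "((\<lambda>x. prof (d_l A) (C_0 A + r) (- r) x t) \<longlongrightarrow> f_l A Tk) (at_right (s t))"
      using prof_lim[OF pos(4) t, of _ _ "s t"] t e3 by metis
    show "\<exists>Ts_x Tl_x.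
          ((\<lambda>x. dx (prof (\<alpha>_s A) P R) x t) \<longlongrightarrow> Ts_x) (at_left (s t)) \<and>
          ((\<lambda>x. dx (prof (\<alpha>_l A) (T_0 A + q) (- q)) x t) \<longlongrightarrow> Tl_x) (at_right (s t)) \<and>
          k_s A * Ts_x - k_l A * Tl_x = \<gamma> A * \<rho> A * deriv s t"
      using prof_dlim[OF pos(1) t] prof_dlim[OF pos(2) t] st'[OF t] by blast
    show "\<exists>Cs_x Cl_x.
          ((\<lambda>x. dx (prof (d_s A) (f_s A Tk) 0) x t) \<longlongrightarrow> Cs_x) (at_left (s t)) \<and>
          ((\<lambda>x. dx (prof (d_l A) (C_0 A + r) (- r)) x t) \<longlongrightarrow> Cl_x) (at_right (s t)) \<and>
          d_l A * Cl_x - d_s A * Cs_x = (f_s A Tk - f_l A Tk) * deriv s t"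
      by (rule exI[of _ 0], rule exI, intro conjI, (use t in \<open>simp add: d0\<close>),
         rule prof_dlim[OF pos(4) t], use co'[OF t] in simp)
  qed (auto intro!: prof_heat pos)
  then show ?thesis unfolding s_def by blast
qed

lemma similarity_solution_ex:
  assumes "admissible A" "similarity_pair A q0 lam Tk"
  shows "\<exists>s Ts Cs Tl Cl. similarity_solution A q0 lam s Tk Ts Cs Tl Cl"
proof -
  have pos: "\<alpha>_s A > 0" "\<alpha>_l A > 0" "d_s A > 0" "d_l A > 0" "k_s A > 0" "k_l A > 0"
    using assms by (auto simp: admissible_def)
  define R where "R = q0 / k_s A * sqrt (pi * \<alpha>_s A)"
  define P where "P = Tk - q0 / k_s A * sqrt (pi * \<alpha>_s A) * erf lam"
  have sp: "lam > 0" "Tk \<in> {T_A A<..<T_B A}" "Tk = F_fun A q0 lam"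
     "Tk \<in> phi_dom A" "M_fun A lam = phi A Tk" using assms by (auto simp: similarity_pair_def)
  have fp: "F1_fun (c_ratio A * lam) > 0" using erfc_pos by (simp add: F1_fun_def)
  have sq: "sqrt (\<alpha>_l A) * sqrt (\<alpha>_l A) = \<alpha>_l A" "sqrt (\<alpha>_s A) * sqrt (\<alpha>_s A) = \<alpha>_s A" using pos by auto
  have ca: "\<alpha>_l A * c_ratio A = sqrt (\<alpha>_l A) * sqrt (\<alpha>_s A)"
    using pos sq by (simp add: c_ratio_def real_sqrt_divide field_simps)
  define X where "X = F1_fun (c_ratio A * lam)"
  have "k_l A * (Tk - T_0 A) = \<gamma> A * \<rho> A * (\<alpha>_l A * c_ratio A) * sqrt pi * lam * X
     - q0 * sqrt (\<alpha>_l A * pi) * exp (- lam\<^sup>2) * X"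
    unfolding sp(3) F_fun_def Q_fun_def X_def F1_fun_def using pos by (simp add: field_simps)
  also have "\<dots> = (sqrt pi * sqrt (\<alpha>_l A) * X) * (\<gamma> A * \<rho> A * lam * sqrt (\<alpha>_s A) - q0 * exp (- lam\<^sup>2))"
    unfolding ca by (simp add: real_sqrt_mult algebra_simps)
  finally have k: "k_l A * (Tk - T_0 A) / (sqrt pi * sqrt (\<alpha>_l A) * X) = \<gamma> A * \<rho> A * lam * sqrt (\<alpha>_s A) - q0 * exp (- lam\<^sup>2)"
    using fp pos by (simp add: X_def)
  have R2: "k_s A * R / (sqrt pi * sqrt (\<alpha>_s A)) * exp (- lam\<^sup>2) = q0 * exp (- lam\<^sup>2)"
    using pos by (simp add: R_def real_sqrt_mult)
  have "\<exists>Cs Tl Cl. alloy_problem A (\<lambda>t. 2 * lam * sqrt (\<alpha>_s A * t)) Tk (prof (\<alpha>_s A) P R) Cs Tl Cl"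
    by (rule alloy_problem_ex) (use assms(1) sp k R2 in \<open>auto simp: P_def R_def X_def\<close>)
  then obtain Cs Tl Cl where ap: "alloy_problem A (\<lambda>t. 2 * lam * sqrt (\<alpha>_s A * t)) Tk (prof (\<alpha>_s A) P R) Cs Tl Cl"
    by blast
  have "\<exists>Ts_x. ((\<lambda>x. dx (prof (\<alpha>_s A) P R) x t) \<longlongrightarrow> Ts_x) (at_right 0) \<and> k_s A * Ts_x = q0 / sqrt t" if "t > 0" for t
    by (rule exI, rule conjI, rule prof_dlim[OF pos(1) that]) (use that pos in \<open>simp add: R_def real_sqrt_mult\<close>)
  with ap assms(2) show ?thesis
    unfolding similarity_solution_def problem_P1_def
    by (intro exI[of _ "\<lambda>t. 2 * lam * sqrt (\<alpha>_s A * t)"] exI[of _ "prof (\<alpha>_s A) P R"] exI[of _ Cs] exI[of _ Tl] exI[of _ Cl])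
      (auto simp: prof_def P_def R_def)
qed

lemma rubinstein_solution_ex:
  assumes "admissible A" "rubinstein_pair A T1 mu Tk"
  shows "\<exists>s Ts Cs Tl Cl. rubinstein_solution A T1 mu s Tk Ts Cs Tl Cl"
proof -
  have pos: "\<alpha>_s A > 0" "\<alpha>_l A > 0" "d_s A > 0" "d_l A > 0" "k_s A > 0" "k_l A > 0"
    using assms by (auto simp: admissible_def)
  define R where "R = (Tk - T1) / erf mu"
  have sp: "mu > 0" "Tk \<in> {T_A A<..<T_B A}" "Tk = G_fun A T1 mu"
     "Tk \<in> phi_dom A" "M_fun A mu = phi A Tk" using assms by (auto simp: rubinstein_pair_def)
  have ep: "erf mu > 0" using sp(1) by (rule erf_pos)
  define u v where "u = sqrt (\<alpha>_l A)" and "v = sqrt (\<alpha>_s A)"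
  have uv: "u > 0" "v > 0" "\<alpha>_l A = u * u" "\<alpha>_s A = v * v" using pos by (auto simp: u_def v_def)
  define w where "w = v / u"
  have vw: "v = u * w" using uv(1) by (simp add: w_def)
  define X where "X = F1_fun (c_ratio A * mu)"
  have X: "X > 0" using erfc_pos by (simp add: F1_fun_def X_def)
  define Y where "Y = exp (mu\<^sup>2) * erf mu"
  have Y: "Y > 0" using ep by (simp add: Y_def)
  have Q1: "Q1_fun mu = sqrt pi * mu * Y" by (simp add: Q1_fun_def Y_def)
  have Q: "Q_fun (c_ratio A * mu) = sqrt pi * (w * mu) * X"
    by (simp add: w_def Q_fun_def X_def F1_fun_def c_ratio_def real_sqrt_divide u_def v_def)
  have den: "k_s A * \<alpha>_l A * Q_fun (c_ratio A * mu) + k_l A * \<alpha>_s A * Q1_fun mu > 0"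
    unfolding Q Q1 using pos uv X Y sp(1) unfolding w_def by (intro add_pos_pos mult_pos_pos divide_pos_pos) auto
  have "Tk * (k_s A * \<alpha>_l A * Q_fun (c_ratio A * mu) + k_l A * \<alpha>_s A * Q1_fun mu) =
     \<gamma> A * \<rho> A * \<alpha>_s A * \<alpha>_l A * Q1_fun mu * Q_fun (c_ratio A * mu)
        + T1 * k_s A * \<alpha>_l A * Q_fun (c_ratio A * mu)
        + T_0 A * k_l A * \<alpha>_s A * Q1_fun mu"
    using den unfolding sp(3) G_fun_def by simp
  then have *: "k_s A * (u * u) * (Tk - T1) * (sqrt pi * (w * mu) * X) + k_l A * (v * v) * (Tk - T_0 A) * (sqrt pi * mu * Y)
     = \<gamma> A * \<rho> A * (v * v) * (u * u) * (sqrt pi * mu * Y) * (sqrt pi * (w * mu) * X)"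
    unfolding Q Q1 uv by (simp add: algebra_simps)
  have "(mu * v * sqrt pi) * (k_s A * u * (Tk - T1) * X + k_l A * v * (Tk - T_0 A) * Y)
     = (mu * v * sqrt pi) * (\<gamma> A * \<rho> A * mu * v * v * u * sqrt pi * X * Y)"
    using * unfolding vw by (simp add: algebra_simps)
  then have key: "k_s A * u * (Tk - T1) * X + k_l A * v * (Tk - T_0 A) * Y
     = \<gamma> A * \<rho> A * mu * v * v * u * sqrt pi * X * Y"
    using uv sp(1) by simp
  have "k_s A * R / (sqrt pi * v) * exp (- mu\<^sup>2) + k_l A * (Tk - T_0 A) / (sqrt pi * u * X)
     = (k_s A * u * (Tk - T1) * X + k_l A * v * (Tk - T_0 A) * Y) / (sqrt pi * u * v * X * Y)"
    using uv X Y ep by (simp add: R_def exp_minus Y_def field_simps)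
  also have "\<dots> = \<gamma> A * \<rho> A * mu * v"
    unfolding key using uv X Y by (simp add: field_simps)
  finally have st: "k_s A * R / (sqrt pi * v) * exp (- mu\<^sup>2) + k_l A * (Tk - T_0 A) / (sqrt pi * u * X) = \<gamma> A * \<rho> A * mu * v" .
  have "\<exists>Cs Tl Cl. alloy_problem A (\<lambda>t. 2 * mu * sqrt (\<alpha>_s A * t)) Tk (prof (\<alpha>_s A) T1 R) Cs Tl Cl"
    by (rule alloy_problem_ex) (use assms(1) sp st ep in \<open>auto simp: R_def X_def u_def v_def\<close>)
  then obtain Cs Tl Cl where ap: "alloy_problem A (\<lambda>t. 2 * mu * sqrt (\<alpha>_s A * t)) Tk (prof (\<alpha>_s A) T1 R) Cs Tl Cl"
    by blast
  have "((\<lambda>x. prof (\<alpha>_s A) T1 R x t) \<longlongrightarrow> T1) (at_right 0)" if "t > 0" for t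
    using prof_lim[OF pos(1) that, of T1 R 0] by (simp add: prof_def)
  with ap assms(2) show ?thesis
    unfolding rubinstein_solution_def problem_PR_def
    by (intro exI[of _ "\<lambda>t. 2 * mu * sqrt (\<alpha>_s A * t)"] exI[of _ "prof (\<alpha>_s A) T1 R"] exI[of _ Cs] exI[of _ Tl] exI[of _ Cl])
      (auto simp: prof_def R_def)
qed

end

theory Submission
  imports Defs "HOL-Real_Asymp.Real_Asymp"
begin

text \<open>
  The flux problem \<open>(P\<^sub>1)\<close> and the temperature problem \<open>(P\<^sub>R)\<close> have the same solution once
  \<open>T\<^sub>1\<close> is read off from the former. At the level of coefficients this is an identity:
  \<open>T\<^sub>k = G(\<lambda>)\<close> is the Stefan condition written with the temperature difference
  \<open>T\<^sub>k - T\<^sub>1\<close>, and for \<open>T\<^sub>1 = T\<^sub>k - (q\<^sub>0 / k\<^sub>s) \<surd>(\<alpha>\<^sub>s \<pi>) erf \<lambda>\<close> it turns into \<open>T\<^sub>k = F(\<lambda>)\<close>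
  (\<open>similarity_pair_imp_rubinstein_pair\<close>).

  It therefore suffices that \<open>(P\<^sub>R)\<close> has at most one pair of coefficients
  (\<open>rubinstein_pair_unique\<close>). Both of its equations are monotone, in opposite senses. Since \<open>Q\<close>
  increases and stays below 1, \<open>M\<close> decreases and stays above 1; where \<open>\<phi>\<close> exceeds 1 it increases;
  so along \<open>M(\<mu>) = \<phi>(T)\<close> a larger \<open>\<mu>\<close> forces a smaller \<open>T\<close>. The heat balance, on the other hand,
  reads
  \<open>T - T\<^sub>1 = a Q\<^sub>1(\<mu>) + b (T\<^sub>0 - T) Q\<^sub>1(\<mu>) / Q(c \<mu>)\<close> with \<open>a, b > 0\<close> and \<open>T < T\<^sub>0\<close>, where \<open>Q\<^sub>1\<close>
  and \<open>Q\<^sub>1 / Q(c \<cdot>)\<close> increase; increasing \<open>\<mu>\<close> and decreasing \<open>T\<close> makes the left side smaller and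
  the right side larger.

  Hence \<open>\<mu> = \<lambda>\<close> and \<open>erf \<mu> = k\<^sub>s (T\<^sub>k - T\<^sub>1) / (q\<^sub>0 \<surd>(\<pi> \<alpha>\<^sub>s))\<close>, and the two bounds on \<open>q\<^sub>0\<close>
  become the two bounds on \<open>erf \<mu>\<close>.
\<close>

section \<open>Bounds and monotonicity for the complementary error function\<close>

lemma erfc_deriv: "(erfc has_real_derivative - (2 / sqrt pi * exp (- x\<^sup>2))) (at x)"
  unfolding erfc_def[abs_def] by (auto intro!: derivative_eq_intros erf_deriv)

lemma erfc_at_top: "(erfc \<longlongrightarrow> 0) at_top"
  unfolding erfc_def[abs_def] using tendsto_diff[OF tendsto_const[of 1] erf_at_top] by simp

lemma pos_of_decreasing_to_0:
  fixes h h' :: "real \<Rightarrow> real"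
  assumes d: "\<And>x. x > 0 \<Longrightarrow> (h has_real_derivative h' x) (at x)"
    and neg: "\<And>x. x > 0 \<Longrightarrow> h' x < 0"
    and lim: "(h \<longlongrightarrow> 0) at_top" and x: "x > 0"
  shows "h x > 0"
proof -
  have dec: "h z < h y" if "0 < y" "y < z" for y z
    using that(2) by (rule DERIV_neg_imp_decreasing) (meson d neg that(1) less_le_trans)
  have "\<forall>\<^sub>F y in at_top. h y \<le> h (x + 1)"
    using eventually_gt_at_top[of "x + 1"]
    by eventually_elim (use x in \<open>auto intro!: less_imp_le dec\<close>)
  then have "0 \<le> h (x + 1)"
    by (rule tendsto_upperbound[OF lim]) simp
  also have "\<dots> < h x" by (rule dec) (use x in auto)
  finally show ?thesis .
qed

text \<open>Equivalently, \<open>erfc x\<close> lies below its leading asymptotic term \<open>exp (- x\<^sup>2) / (\<surd>\<pi> x)\<close>: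
  the difference of the two decreases to 0.\<close>

lemma Q_fun_less_1:
  assumes x: "x > 0"
  shows "Q_fun x < 1"
proof -
  define h where "h = (\<lambda>x. exp (- x\<^sup>2) / (sqrt pi * x) - erfc x)"
  have "h x > 0"
  proof (rule pos_of_decreasing_to_0[OF _ _ _ x])
    fix x :: real assume x: "x > 0"
    have num: "((\<lambda>x. exp (- x\<^sup>2)) has_real_derivative exp (- x\<^sup>2) * (- 2 * x)) (at x)"
      and den: "((\<lambda>x. sqrt pi * x) has_real_derivative sqrt pi) (at x)"
      by (auto intro!: derivative_eq_intros)
    have "(E * (- 2 * x) * (r * x) - E * r) / (r * x * (r * x)) - - (2 / r * E) = - E / (r * x\<^sup>2)"
      if "r > 0" for E r :: real
      using that x by (simp add: divide_simps) (simp add: algebra_simps power2_eq_square)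
    then show "(h has_real_derivative - exp (- x\<^sup>2) / (sqrt pi * x\<^sup>2)) (at x)"
      unfolding h_def using DERIV_diff[OF DERIV_divide[OF num den] erfc_deriv] x by simp
    show "- exp (- x\<^sup>2) / (sqrt pi * x\<^sup>2) < 0"
      using x by simp
  next
    have "((\<lambda>x::real. exp (- x\<^sup>2) / (sqrt pi * x)) \<longlongrightarrow> 0) at_top"
      by real_asymp
    from tendsto_diff[OF this erfc_at_top] show "(h \<longlongrightarrow> 0) at_top"
      by (simp add: h_def)
  qed
  then have "erfc x < exp (- x\<^sup>2) / (sqrt pi * x)" by (simp add: h_def)
  then show ?thesis
    using x by (simp add: Q_fun_def exp_minus field_simps)
qed

text \<open>This second bound is what makes the derivative of \<open>Q\<close> positive; it is the first convergent of
  the continued fraction of \<open>erfc\<close> lying below the function, and again the difference decreases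
  to 0.\<close>

lemma erfc_lower_bound:
  assumes x: "x > 0"
  shows "2 / sqrt pi * x * exp (- x\<^sup>2) / (1 + 2 * x\<^sup>2) < erfc x"
proof -
  define h where "h = (\<lambda>x. erfc x - 2 / sqrt pi * (x * exp (- x\<^sup>2) / (1 + 2 * x\<^sup>2)))"
  have "h x > 0"
  proof (rule pos_of_decreasing_to_0[OF _ _ _ x])
    fix x :: real
    have p: "1 + 2 * x\<^sup>2 > 0" by (simp add: add_pos_nonneg)
    define D where "D = 1 + 2 * x\<^sup>2"
    have D: "D > 0" using p by (simp add: D_def)
    have num: "((\<lambda>x. x * exp (- x\<^sup>2)) has_real_derivative exp (- x\<^sup>2) * (2 - D)) (at x)"
      unfolding D_def
      by (auto intro!: derivative_eq_intros simp: algebra_simps power2_eq_square)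
    have den: "((\<lambda>x. 1 + 2 * x\<^sup>2) has_real_derivative 4 * x) (at x)"
      by (auto intro!: derivative_eq_intros)
    have "(exp (- x\<^sup>2) * (2 - D) * D - x * exp (- x\<^sup>2) * (4 * x)) / (D * D)
        = exp (- x\<^sup>2) * (((2 - D) * D - (2 * D - 2)) / (D * D))"
      by (simp add: D_def algebra_simps power2_eq_square)
    also have "((2 - D) * D - (2 * D - 2)) / (D * D) = 2 / D\<^sup>2 - 1"
      using D by (simp add: diff_divide_distrib algebra_simps power2_eq_square)
    finally have g: "((\<lambda>x. x * exp (- x\<^sup>2) / (1 + 2 * x\<^sup>2)) has_real_derivative
        exp (- x\<^sup>2) * (2 / (1 + 2 * x\<^sup>2)\<^sup>2 - 1)) (at x)"
      using DERIV_divide[OF num den] p by (simp add: D_def)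
    show "(h has_real_derivative
        - (2 / sqrt pi * exp (- x\<^sup>2)) - 2 / sqrt pi * (exp (- x\<^sup>2) * (2 / (1 + 2 * x\<^sup>2)\<^sup>2 - 1))) (at x)"
      unfolding h_def by (intro DERIV_diff erfc_deriv DERIV_cmult g)
    have "- (2 / sqrt pi * exp (- x\<^sup>2)) - 2 / sqrt pi * (exp (- x\<^sup>2) * (2 / (1 + 2 * x\<^sup>2)\<^sup>2 - 1))
        = - (2 / sqrt pi * (exp (- x\<^sup>2) * (2 / (1 + 2 * x\<^sup>2)\<^sup>2)))"
      by (simp add: algebra_simps)
    also have "\<dots> < 0" using p by simp
    finally show "- (2 / sqrt pi * exp (- x\<^sup>2))
        - 2 / sqrt pi * (exp (- x\<^sup>2) * (2 / (1 + 2 * x\<^sup>2)\<^sup>2 - 1)) < 0" .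
  next
    have "((\<lambda>x::real. 2 / sqrt pi * (x * exp (- x\<^sup>2) / (1 + 2 * x\<^sup>2))) \<longlongrightarrow> 0) at_top"
      by real_asymp
    from tendsto_diff[OF erfc_at_top this] show "(h \<longlongrightarrow> 0) at_top"
      by (simp add: h_def)
  qed
  then show ?thesis by (simp add: h_def mult.assoc)
qed

lemma F1_fun_pos: "F1_fun x > 0"
  using erfc_pos by (simp add: F1_fun_def)

lemma F1_fun_deriv: "(F1_fun has_real_derivative 2 * x * F1_fun x - 2 / sqrt pi) (at x)"
  unfolding F1_fun_def[abs_def]
  by (rule derivative_eq_intros erfc_deriv refl | simp)+ (simp add: exp_minus field_simps)

lemma Q_fun_eq_F1_fun: "Q_fun x = sqrt pi * x * F1_fun x"
  by (simp add: Q_fun_def F1_fun_def)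

lemma Q_fun_pos: "x > 0 \<Longrightarrow> Q_fun x > 0"
  by (simp add: Q_fun_eq_F1_fun F1_fun_pos)

lemma F1_fun_strict_antimono:
  assumes "0 < x" "x < y"
  shows "F1_fun y < F1_fun x"
  using assms(2)
proof (rule DERIV_neg_imp_decreasing)
  fix z assume "x \<le> z"
  then have "Q_fun z < 1" using assms by (intro Q_fun_less_1) auto
  then have "2 * z * F1_fun z - 2 / sqrt pi < 0"
    by (simp add: Q_fun_eq_F1_fun field_simps)
  then show "\<exists>d. DERIV F1_fun z :> d \<and> d < 0" using F1_fun_deriv by blast
qed

lemma Q_fun_strict_mono:
  assumes "0 < x" "x < y"
  shows "Q_fun x < Q_fun y"
  using assms(2)
proof (rule DERIV_pos_imp_increasing)
  fix z assume "x \<le> z"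
  then have z: "z > 0" using assms by auto
  have p: "1 + 2 * z\<^sup>2 > 0" by (simp add: add_pos_nonneg)
  have "2 / sqrt pi * z / exp (z\<^sup>2) < erfc z * (1 + 2 * z\<^sup>2)"
    using erfc_lower_bound[OF z]
    by (simp only: pos_divide_less_eq[OF p] exp_minus divide_inverse[symmetric])
  then have "2 / sqrt pi * z < erfc z * (1 + 2 * z\<^sup>2) * exp (z\<^sup>2)"
    by (simp only: pos_divide_less_eq[OF exp_gt_zero])
  also have "\<dots> = (1 + 2 * z\<^sup>2) * F1_fun z" by (simp add: F1_fun_def)
  finally have lt: "2 / sqrt pi * z < (1 + 2 * z\<^sup>2) * F1_fun z" .
  have "(Q_fun has_real_derivative sqrt pi * ((1 + 2 * z\<^sup>2) * F1_fun z - 2 / sqrt pi * z)) (at z)"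
    unfolding Q_fun_eq_F1_fun[abs_def]
    by (rule derivative_eq_intros F1_fun_deriv refl | simp)+
       (simp add: algebra_simps power2_eq_square)
  moreover have "sqrt pi * ((1 + 2 * z\<^sup>2) * F1_fun z - 2 / sqrt pi * z) > 0"
    using lt by simp
  ultimately show "\<exists>d. DERIV Q_fun z :> d \<and> d > 0" by blast
qed

lemma Q1_fun_pos: "x > 0 \<Longrightarrow> Q1_fun x > 0"
  by (simp add: Q1_fun_def erf_pos)

lemma exp_square_erf_strict_mono:
  assumes "0 < x" "x < y"
  shows "exp (x\<^sup>2) * erf x < exp (y\<^sup>2) * erf y"
  using assms erf_pos[of x] erf_strict_mono[of x y]
  by (intro mult_strict_mono) (auto intro: power_strict_mono)

lemma Q1_fun_strict_mono:
  assumes "0 < x" "x < y"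
  shows "Q1_fun x < Q1_fun y"
proof -
  have "x * (exp (x\<^sup>2) * erf x) < y * (exp (y\<^sup>2) * erf y)"
    using assms erf_pos[of x] by (intro mult_strict_mono exp_square_erf_strict_mono) auto
  then show ?thesis by (simp add: Q1_fun_def mult.assoc)
qed

text \<open>The common factor \<open>\<surd>\<pi> x\<close> of \<open>Q\<^sub>1\<close> and \<open>Q\<close> cancels, which leaves an increasing numerator
  over a decreasing denominator.\<close>

lemma Q1_over_Q_eq:
  assumes "x > 0"
  shows "Q1_fun x / Q_fun (c * x) = exp (x\<^sup>2) * erf x / (c * F1_fun (c * x))"
  using assms by (simp add: Q1_fun_def Q_fun_eq_F1_fun)

lemma Q1_over_Q_strict_mono:
  assumes "c > 0" "0 < x" "x < y"
  shows "Q1_fun x / Q_fun (c * x) < Q1_fun y / Q_fun (c * y)"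
proof -
  have "y > 0" using assms by simp
  have "exp (x\<^sup>2) * erf x / (c * F1_fun (c * x)) < exp (y\<^sup>2) * erf y / (c * F1_fun (c * y))"
    using assms \<open>y > 0\<close> F1_fun_pos[of "c * x"] F1_fun_pos[of "c * y"] erf_pos[of x]
      F1_fun_strict_antimono[of "c * x" "c * y"]
    by (intro frac_less2 mult_pos_pos less_imp_le exp_square_erf_strict_mono
        mult_strict_left_mono) auto
  then show ?thesis using assms \<open>y > 0\<close> by (simp add: Q1_over_Q_eq)
qed

section \<open>The coefficient equations\<close>

lemma admissible_pos:
  assumes "admissible A"
  shows "\<alpha>_s A > 0" "\<alpha>_l A > 0" "d_l A > 0" "k_s A > 0" "k_l A > 0" "\<rho> A > 0" "\<gamma> A > 0"
    "c_ratio A > 0"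
  using assms by (auto simp: admissible_def c_ratio_def)

lemma M_fun_gt_1:
  assumes "admissible A" "x > 0"
  shows "M_fun A x > 1"
  using assms admissible_pos[OF assms(1)]
  by (auto simp: M_fun_def one_less_inverse_iff intro!: Q_fun_pos Q_fun_less_1)

lemma M_fun_strict_antimono:
  assumes "admissible A" "0 < x" "x < y"
  shows "M_fun A y < M_fun A x"
  using assms admissible_pos[OF assms(1)]
  by (auto simp: M_fun_def intro!: less_imp_inverse_less Q_fun_pos Q_fun_strict_mono)

text \<open>Between \<open>T\<^sub>A\<close> and \<open>T\<^sub>B\<close> the numerator of \<open>\<phi>\<close> is positive, so \<open>\<phi>\<close> has the sign of
  \<open>C\<^sub>0 - f\<^sub>l\<close>; once this is positive, \<open>\<phi> > 1\<close> compares \<open>f\<^sub>s\<close> with \<open>C\<^sub>0\<close>.\<close>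

lemma phi_gt_1:
  assumes "admissible A" "T \<in> {T_A A<..<T_B A}" "phi A T > 1"
  shows "f_l A T < C_0 A" "C_0 A < f_s A T"
proof -
  have "f_l A T < f_s A T" using assms by (auto simp: admissible_def)
  then show *: "f_l A T < C_0 A"
    using assms(3) by (cases "C_0 A - f_l A T" "0 :: real" rule: linorder_cases)
      (auto simp: phi_def field_simps)
  show "C_0 A < f_s A T"
    using assms(3) * by (simp add: phi_def field_simps)
qed

lemma less_T_0:
  assumes "admissible A" "T \<in> {T_A A..T_B A}" "f_l A T \<le> C_0 A"
  shows "T < T_0 A"
proof -
  have T0: "T_0 A \<in> {T_A A..T_B A}" and lt: "f_l A T < f_l A (T_0 A)"
    using assms by (auto simp: admissible_def)
  have "strict_mono_on {T_A A..T_B A} (f_l A)" using assms by (simp add: admissible_def)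
  from strict_mono_on_less[OF this assms(2) T0] lt show ?thesis by simp
qed

text \<open>On the region where \<open>\<phi> = 1 + (f\<^sub>s - C\<^sub>0) / (C\<^sub>0 - f\<^sub>l)\<close> exceeds 1, numerator and denominator of
  the fraction are positive, the former increasing and the latter decreasing.\<close>

lemma phi_strict_mono:
  assumes A: "admissible A" and T: "T \<in> {T_A A<..<T_B A}" "T' \<in> {T_A A<..<T_B A}"
    and gt: "phi A T > 1" "phi A T' > 1" and lt: "T < T'"
  shows "phi A T < phi A T'"
proof -
  have eq: "phi A S = 1 + (f_s A S - C_0 A) / (C_0 A - f_l A S)"
    if "S \<in> {T_A A<..<T_B A}" "phi A S > 1" for S
    using phi_gt_1[OF A that] by (simp add: phi_def field_simps)
  have "f_l A T < f_l A T'" "f_s A T < f_s A T'"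
    using A T lt by (auto simp: admissible_def strict_mono_on_def)
  then have "(f_s A T - C_0 A) / (C_0 A - f_l A T) < (f_s A T' - C_0 A) / (C_0 A - f_l A T')"
    using phi_gt_1[OF A T(1) gt(1)] phi_gt_1[OF A T(2) gt(2)] by (intro frac_less2) auto
  then show ?thesis using eq[OF T(1) gt(1)] eq[OF T(2) gt(2)] by simp
qed

text \<open>Dividing the defining equation of \<open>G\<close> by \<open>Q(c x)\<close> isolates the two monotone quantities
  \<open>Q\<^sub>1\<close> and \<open>Q\<^sub>1 / Q(c \<cdot>)\<close>.\<close>

lemma eq_G_fun_iff:
  assumes A: "admissible A" and x: "x > 0"
  shows "T = G_fun A T1 x \<longleftrightarrow>
    T - T1 = \<gamma> A * \<rho> A * \<alpha>_s A / k_s A * Q1_fun x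
      + k_l A * \<alpha>_s A / (k_s A * \<alpha>_l A) * ((T_0 A - T) * (Q1_fun x / Q_fun (c_ratio A * x)))"
proof -
  note pos = admissible_pos[OF A]
  define q p where "q = Q_fun (c_ratio A * x)" and "p = Q1_fun x"
  have q: "q > 0" and p: "p > 0" using x pos by (auto simp: q_def p_def Q_fun_pos Q1_fun_pos)
  have den: "k_s A * \<alpha>_l A * q + k_l A * \<alpha>_s A * p > 0"
    using pos q p by (intro add_pos_pos mult_pos_pos)
  have "T = G_fun A T1 x \<longleftrightarrow> T * (k_s A * \<alpha>_l A * q + k_l A * \<alpha>_s A * p) =
     \<gamma> A * \<rho> A * \<alpha>_s A * \<alpha>_l A * p * q + T1 * k_s A * \<alpha>_l A * q + T_0 A * k_l A * \<alpha>_s A * p"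
    unfolding G_fun_def q_def[symmetric] p_def[symmetric] using den
    by (subst eq_divide_eq) simp
  also have "\<dots> \<longleftrightarrow> (T - T1) * (k_s A * \<alpha>_l A * q)
      = \<gamma> A * \<rho> A * \<alpha>_s A * \<alpha>_l A * p * q + k_l A * \<alpha>_s A * ((T_0 A - T) * p)"
    by (auto simp: algebra_simps)
  also have "\<gamma> A * \<rho> A * \<alpha>_s A * \<alpha>_l A * p * q + k_l A * \<alpha>_s A * ((T_0 A - T) * p)
      = (\<gamma> A * \<rho> A * \<alpha>_s A / k_s A * p
        + k_l A * \<alpha>_s A / (k_s A * \<alpha>_l A) * ((T_0 A - T) * (p / q))) * (k_s A * \<alpha>_l A * q)"
    using pos q by (simp add: distrib_right)
  also have "(T - T1) * (k_s A * \<alpha>_l A * q) = \<dots> \<longleftrightarrow> T - T1 = \<gamma> A * \<rho> A * \<alpha>_s A / k_s A * p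
      + k_l A * \<alpha>_s A / (k_s A * \<alpha>_l A) * ((T_0 A - T) * (p / q))"
    using pos q by (subst mult_cancel_right) simp
  finally show ?thesis unfolding q_def p_def .
qed

text \<open>Opposite monotonicity of the two equations in \<open>(\<mu>, T)\<close>.\<close>

lemma rubinstein_pair_not_less:
  assumes A: "admissible A" and r: "rubinstein_pair A T1 x T" "rubinstein_pair A T1 y T'"
  shows "\<not> x < y"
proof
  assume lt: "x < y"
  note pos = admissible_pos[OF A]
  have x: "0 < x" "T \<in> {T_A A<..<T_B A}" "T = G_fun A T1 x" "M_fun A x = phi A T"
    and y: "0 < y" "T' \<in> {T_A A<..<T_B A}" "T' = G_fun A T1 y" "M_fun A y = phi A T'"
    using r by (auto simp: rubinstein_pair_def)
  have gt: "phi A T > 1" "phi A T' > 1"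
    using M_fun_gt_1[OF A x(1)] M_fun_gt_1[OF A y(1)] x y by simp_all
  have "phi A T' < phi A T"
    using M_fun_strict_antimono[OF A x(1) lt] x y by simp
  then have T: "T' < T"
    using phi_strict_mono[OF A x(2) y(2) gt] by (cases T T' rule: linorder_cases) auto
  have T0: "T < T_0 A"
    using x phi_gt_1[OF A x(2) gt(1)] by (intro less_T_0[OF A]) auto
  let ?R = "\<lambda>z. Q1_fun z / Q_fun (c_ratio A * z)"
  have "?R x > 0" using x pos by (simp add: Q_fun_pos Q1_fun_pos)
  then have "(T_0 A - T) * ?R x < (T_0 A - T') * ?R y"
    using T T0 Q1_over_Q_strict_mono[OF pos(8) x(1) lt] by (intro mult_strict_mono) auto
  then have "T - T1 < T' - T1"
    unfolding x(3)[unfolded eq_G_fun_iff[OF A x(1)]] y(3)[unfolded eq_G_fun_iff[OF A y(1)]]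
    using pos Q1_fun_strict_mono[OF x(1) lt]
    by (intro add_strict_mono mult_strict_left_mono) auto
  with T show False by simp
qed

lemma rubinstein_pair_unique:
  assumes "admissible A" "rubinstein_pair A T1 x T" "rubinstein_pair A T1 y T'"
  shows "x = y" "T = T'"
proof -
  show "x = y"
    using rubinstein_pair_not_less[OF assms] rubinstein_pair_not_less[OF assms(1,3,2)] by simp
  then show "T = T'" using assms by (simp add: rubinstein_pair_def)
qed

text \<open>Substituting \<open>T = F(\<lambda>)\<close> into the balance \<open>eq_G_fun_iff\<close>, the term of \<open>F\<close> with \<open>Q\<close> cancels
  the latent heat term of the balance, and the term with \<open>q\<^sub>0\<close> equals \<open>T - T\<^sub>1\<close>.\<close>

lemma similarity_pair_imp_rubinstein_pair:
  assumes A: "admissible A" and sp: "similarity_pair A q0 lam T"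
  shows "rubinstein_pair A (T - q0 / k_s A * sqrt (\<alpha>_s A * pi) * erf lam) lam T"
proof -
  note pos = admissible_pos[OF A]
  have lam: "lam > 0" and T: "T = F_fun A q0 lam" using sp by (auto simp: similarity_pair_def)
  define u v where "u = sqrt (\<alpha>_l A)" and "v = sqrt (\<alpha>_s A)"
  have uv: "u > 0" "v > 0" "\<alpha>_l A = u * u" "\<alpha>_s A = v * v" "c_ratio A = v / u"
    using pos by (auto simp: u_def v_def c_ratio_def real_sqrt_divide)
  have sq: "sqrt (\<alpha>_s A * pi) = v * sqrt pi" "sqrt (\<alpha>_l A * pi) = u * sqrt pi"
    by (simp_all add: u_def v_def real_sqrt_mult)
  define X where "X = F1_fun (c_ratio A * lam)"
  have X: "X > 0" by (simp add: X_def F1_fun_pos)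
  define q where "q = Q_fun (c_ratio A * lam)"
  have q: "q > 0" using lam pos by (simp add: q_def Q_fun_pos)
  have R: "Q1_fun lam / q = exp (lam\<^sup>2) * erf lam / (v / u * X)"
    unfolding q_def X_def Q1_over_Q_eq[OF lam] by (simp add: uv)
  have dT: "T_0 A - T = q0 / k_l A * (u * sqrt pi) * exp (- lam\<^sup>2) * X
      - \<gamma> A * \<rho> A * \<alpha>_l A / k_l A * q"
    unfolding T F_fun_def X_def q_def sq by simp
  have flux: "k_l A * \<alpha>_s A / (k_s A * \<alpha>_l A)
      * (q0 / k_l A * (u * sqrt pi) * exp (- lam\<^sup>2) * X * (Q1_fun lam / q))
      = q0 / k_s A * (v * sqrt pi) * erf lam"
    unfolding R uv(3,4) using pos(4,5) uv(1,2) X by (simp add: exp_minus field_simps)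
  have latent: "k_l A * \<alpha>_s A / (k_s A * \<alpha>_l A)
      * (\<gamma> A * \<rho> A * \<alpha>_l A / k_l A * q * (Q1_fun lam / q))
      = \<gamma> A * \<rho> A * \<alpha>_s A / k_s A * Q1_fun lam"
    using pos q by simp
  have "T = G_fun A (T - q0 / k_s A * sqrt (\<alpha>_s A * pi) * erf lam) lam"
    unfolding eq_G_fun_iff[OF A lam] q_def[symmetric] sq dT left_diff_distrib right_diff_distrib
      flux latent
    by simp
  then show ?thesis
    using sp by (auto simp: similarity_pair_def rubinstein_pair_def)
qed

lemma T_0l_less_T_0:
  assumes A: "admissible A"
  shows "T_0l A < T_0 A"
proof -
  have inj: "inj_on (f_l A) {T_A A..T_B A}"
    using A by (auto simp: admissible_def intro: strict_mono_on_imp_inj_on)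
  have "C_0 A \<in> f_l A ` {T_A A..T_B A}"
    using A IVT'[of "f_l A" "T_A A" "C_0 A" "T_B A"] by (force simp: admissible_def)
  then have "f_l A (T_0l A) = C_0 A" "T_0l A \<in> {T_A A..T_B A}"
    unfolding T_0l_def using f_the_inv_into_f[OF inj] the_inv_into_into[OF inj _ subset_refl]
    by blast+
  then show ?thesis by (intro less_T_0[OF A]) auto
qed

section \<open>The bounds for the Rubinstein solution\<close>

theorem corollary3p2:
  fixes A :: alloy and q0 lam Tk T1 mu Tk' :: real
    and s s' :: "real \<Rightarrow> real"
    and Ts Cs Tl Cl Ts' Cs' Tl' Cl' :: "real \<Rightarrow> real \<Rightarrow> real"
  assumes "admissible A"
    and "q0 > 0"
    and "(T_0 A - T_0l A) * k_l A / sqrt (pi * \<alpha>_l A) < q0"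
    and "q0 < (T_0 A - T_0s A) * k_l A / sqrt (pi * \<alpha>_l A)"
    and "similarity_solution A q0 lam s Tk Ts Cs Tl Cl"
    and "T1 = Tk - q0 / k_s A * sqrt (\<alpha>_s A * pi) * erf lam"
    and "rubinstein_solution A T1 mu s' Tk' Ts' Cs' Tl' Cl'"
  shows "sqrt (\<alpha>_l A) / sqrt (\<alpha>_s A) * ((Tk' - T1) / (T_0 A - T_0s A)) * (k_s A / k_l A) < erf mu
       \<and> erf mu < sqrt (\<alpha>_l A) / sqrt (\<alpha>_s A) * ((Tk' - T1) / (T_0 A - T_0l A)) * (k_s A / k_l A)"
proof -
  note pos = admissible_pos[OF assms(1)]
  have sp: "similarity_pair A q0 lam Tk" and rp: "rubinstein_pair A T1 mu Tk'"
    using assms by (auto simp: similarity_solution_def rubinstein_solution_def)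
  have "rubinstein_pair A T1 lam Tk"
    using similarity_pair_imp_rubinstein_pair[OF assms(1) sp] assms(6) by simp
  from rubinstein_pair_unique[OF assms(1) rp this] have eq: "lam = mu" "Tk = Tk'" by simp_all
  have e: "erf mu > 0" using rp by (simp add: rubinstein_pair_def erf_pos)
  define B where "B = q0 * sqrt (pi * \<alpha>_l A)"
  have root: "sqrt (pi * \<alpha>_l A) > 0" using pos by simp
  \<comment> \<open>Inserting \<open>T\<^sub>k - T\<^sub>1\<close>, both bounds become \<open>erf \<mu>\<close> times a quotient to be compared with 1.\<close>
  have bound: "sqrt (\<alpha>_l A) / sqrt (\<alpha>_s A) * ((Tk' - T1) / D) * (k_s A / k_l A)
      = erf mu * (B / (D * k_l A))" for D
    using pos unfolding assms(6) eq B_def by (simp add: real_sqrt_mult)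
  have l: "(T_0 A - T_0l A) * k_l A < B" and u: "B < (T_0 A - T_0s A) * k_l A"
    using assms(3,4) root by (simp_all add: B_def pos_divide_less_eq pos_less_divide_eq)
  have Dl: "(T_0 A - T_0l A) * k_l A > 0" using T_0l_less_T_0[OF assms(1)] pos by simp
  have "B / ((T_0 A - T_0s A) * k_l A) < 1" using l u Dl by simp
  moreover have "1 < B / ((T_0 A - T_0l A) * k_l A)" using l Dl by simp
  ultimately show ?thesis
    unfolding bound using e
    by (simp only: mult_less_cancel_left1 mult_less_cancel_left2 less_imp_le) auto
qed

end
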